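(* Let $(D,\sqsubseteq)$ be a partial ordering, let $F$ be a set of prop rules on $D$, and let $r=b\to g$ be a prop rule with witness $w$ for $b$. Suppose $e$ is the least common fixpoint of the rules in $F$ among the elements $\sqsupseteq w$. If $g(e)=e$, then $r$ is redundant with respect to $F$, i.e., the set of common fixpoints of $F$ equals the set of common fixpoints of $F\cup\{r\}$.
   Context: A function $f:D\to D$ is stable if for all $d,e\in D$, $f(d)\sqsubseteq e$ implies $f(e)=e$. A condition $b$ is a predicate on $D$; "$b$ holds in $d$" means it evaluates to true at $d$. $b$ is monotonic if $b$ holding in $d$ and $d\sqsubseteq e$ imply $b$ holds in $e$; $b$ is precise if there is a least element $d$ in which $b$ holds, called the witness of $b$. A rule $b\to g$ consists of a condition $b$ and a function $g:D\to D$ (its body) and acts on $D$ by $(b\to g)(d)=g(d)$ if $b$ holds in $d$, and $(b\to g)(d)=d$ otherwise. A prop rule is a rule $b\to g$ with $b$ monotonic and precise and $g$ stable. A fixpoint of a set of functions means a common fixpoint of all of them. *)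

theory Defs
  imports Main
begin

definition stable :: "('a::order \<Rightarrow> 'a) \<Rightarrow> bool" where
  "stable f \<longleftrightarrow> (\<forall>d e. f d \<le> e \<longrightarrow> f e = e)"

definition least_in :: "'a::order set \<Rightarrow> 'a \<Rightarrow> bool" where
  "least_in S d \<longleftrightarrow> d \<in> S \<and> (\<forall>x\<in>S. d \<le> x)"

definition monotonic :: "('a::order \<Rightarrow> bool) \<Rightarrow> bool" where
  "monotonic b \<longleftrightarrow> (\<forall>d e. b d \<and> d \<le> e \<longrightarrow> b e)"

definition witness :: "('a::order \<Rightarrow> bool) \<Rightarrow> 'a \<Rightarrow> bool" where
  "witness b w \<longleftrightarrow> least_in {d. b d} w"

definition precise :: "('a::order \<Rightarrow> bool) \<Rightarrow> bool" where
  "precise b \<longleftrightarrow> (\<exists>w. witness b w)"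

datatype 'a rule = Rule (condition: "'a \<Rightarrow> bool") (body: "'a \<Rightarrow> 'a")

definition apply_rule :: "'a rule \<Rightarrow> 'a \<Rightarrow> 'a" where
  "apply_rule r d = (if condition r d then body r d else d)"

definition prop_rule :: "('a::order) rule \<Rightarrow> bool" where
  "prop_rule r \<longleftrightarrow> monotonic (condition r) \<and> precise (condition r) \<and> stable (body r)"

definition common_fixpoints :: "('a \<Rightarrow> 'a) set \<Rightarrow> 'a set" where
  "common_fixpoints G = {d. \<forall>f\<in>G. f d = d}"

definition redundant :: "'a rule \<Rightarrow> 'a rule set \<Rightarrow> bool" where
  "redundant r F \<longleftrightarrow>
     common_fixpoints (apply_rule ` F) = common_fixpoints (apply_rule ` (F \<union> {r}))"

end

theory Submission imports Defs begin

text \<open>Adding \<open>r\<close> can only shrink the set of common fixpoints, so it suffices that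
  \<open>r\<close> fixes every common fixpoint \<open>d\<close> of \<open>F\<close>. Where
  \<open>b\<close> fails, \<open>r\<close> acts as the identity. Where \<open>b\<close> holds,
  \<open>d\<close> lies above the witness \<open>w\<close>, hence above \<open>e\<close>, and
  stability of \<open>g\<close> carries the fixpoint property from \<open>e\<close> up to
  \<open>d\<close>.\<close>

theorem theorem5:
  fixes F :: "('a::order) rule set"
    and r :: "'a rule"
    and b :: "'a \<Rightarrow> bool"
    and g :: "'a \<Rightarrow> 'a"
    and w e :: 'a
  assumes "\<forall>f\<in>F. prop_rule f"
    and "r = Rule b g"
    and "prop_rule r"
    and "witness b w"
    and "least_in {d \<in> common_fixpoints (apply_rule ` F). w \<le> d} e"
    and "g e = e"
  shows "redundant r F"
proof -
  have "apply_rule r d = d" if d: "d \<in> common_fixpoints (apply_rule ` F)" for d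
  proof (cases "b d")
    case True
    then have "w \<le> d"
      using assms(4) by (simp add: witness_def least_in_def)
    then have "e \<le> d"
      using assms(5) d by (simp add: least_in_def)
    \<comment> \<open>Writing \<open>e\<close> as a value of \<open>g\<close> gives the premise of
      stability: \<open>g\<close> fixes every element above one of its values.\<close>
    then have "g e \<le> d"
      using assms(6) by simp
    then have "g d = d"
      using assms(2,3) by (auto simp: prop_rule_def stable_def)
    then show ?thesis
      using assms(2) by (simp add: apply_rule_def)
  next
    case False
    then show ?thesis
      using assms(2) by (simp add: apply_rule_def)
  qed
  then show ?thesis
    by (auto simp: redundant_def common_fixpoints_def)
qed

end
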